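(* Let $(\overline{\mathcal{D}}^{(1)}_{m,n_m},\overline{\mathcal{D}}^{(2)}_{m,n_m})$, $m\in\mathbb{N}$, be a family of pairs of correlated labeled databases generated based on the I.I.D. database model with distribution $P_{U^{(1)},U^{(2)}}$, a probability measure on $\mathbb{R}^2$, and let $R=\lim_{m\to\infty}\frac1m\log_2 n_m$ be its (finite) rate of growth. A successful matching scheme exists for this family if $$R< I(U^{(1)};U^{(2)}),$$ where $I(U^{(1)};U^{(2)})$ is the mutual information of $(U^{(1)},U^{(2)})\sim P_{U^{(1)},U^{(2)}}$.
   Context: Notation: $[n]=\{1,\dots,n\}$; mutual information is in bits. Family of pairs of correlated labeled databases (I.I.D. model). The family is characterized by the sizes, the labeling functions and the distribution. $(n_m)_{m\in\mathbb{N}}$ is an increasing sequence of natural numbers. For each $m$ and $j\in\{1,2\}$, $\Theta^{(j)}_m:[n_m]\to[n_m]$ is a bijection, called the labeling function, with $\Theta^{(j)}_m(i)=\Theta^{(j)}_{m'}(i)$ for all $i\le\min(m,m')$. The (unlabeled) database $\mathcal{D}^{(j)}_{m,n_m}$ is the multiset of random entries $U^{(j),m}_i=(U^{(j)}_{i,1},\dots,U^{(j)}_{i,m})\in\mathbb{R}^m$, $i\in[n_m]$, and $\overline{\mathcal{D}}^{(j)}_{m,n_m}=(\mathcal{D}^{(j)}_{m,n_m},\Theta^{(j)}_m)$. Entries $U^{(1),m}_{i_1}$ and $U^{(2),m}_{i_2}$ are called matching if $\Theta^{(1)}_m(i_1)=\Theta^{(2)}_m(i_2)$. The pairs of matching entries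 are independent of each other, and for each matching pair the coordinate pairs $(U^{(1)}_{i_1,k},U^{(2)}_{i_2,k})$, $k\in[m]$, are i.i.d. with law $P_{U^{(1)},U^{(2)}}$. Matching scheme. A matching scheme is a sequence of mappings $f_m:(\overline{\mathcal{D}}^{(1)}_{m,n_m},\mathcal{D}^{(2)}_{m,n_m})\mapsto\widehat{\Theta}^{(2)}_m$, where $\widehat{\Theta}^{(2)}_m$ is a reconstruction of the labeling function $\Theta^{(2)}_m$; the labeling function of the first database is given to the scheme, that of the second is not. It is successful if $P(\widehat{\Theta}^{(2)}_m(J)=\Theta^{(2)}_m(J))\to1$ as $m\to\infty$, where $J$ is uniformly distributed over $[n_m]$. *)

theory Defs
  imports "HOL-Probability.Probability"
begin

section \<open>Mutual information in bits, with values in the extended reals\<close>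

text \<open>
  The library's \<^term>\<open>KL_divergence\<close> is a Bochner integral and returns a junk real where the
  relative entropy is infinite: when the joint law is not absolutely continuous with respect to
  the product of the marginals, and when the entropy density is not integrable. In the second
  case its negative part is still integrable (as \<open>x log x\<close> is bounded below), so the value is
  \<open>\<infinity>\<close> there too.
\<close>

definition mutual_information_bits :: "(real \<times> real) measure \<Rightarrow> ereal" where
  "mutual_information_bits P =
    (let joint = distr P (borel \<Otimes>\<^sub>M borel) (\<lambda>u. (fst u, snd u));
         indep = distr P borel fst \<Otimes>\<^sub>M distr P borel snd
     in if absolutely_continuous indep joint \<and> integrable joint (entropy_density 2 indep joint)
        then ereal (prob_space.mutual_information P 2 borel borel fst snd)
        else \<infinity>)"


section \<open>Labelings and databases\<close>

type_synonym labeling = "nat \<Rightarrow> nat"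

definition is_labeling :: "nat \<Rightarrow> labeling \<Rightarrow> bool" where
  "is_labeling N \<theta> \<longleftrightarrow> bij_betw \<theta> {1..N} {1..N}"

text \<open>
  A database with \<open>N\<close> entries of length \<open>m\<close> is the family of its entries, indexed by
  \<open>{1..N}\<close>: repeated entries are kept apart, and the indices are what a labeling is applied to.
\<close>

type_synonym database = "nat \<Rightarrow> nat \<Rightarrow> real"

definition database_space :: "nat \<Rightarrow> nat \<Rightarrow> database measure" where
  "database_space m N = (\<Pi>\<^sub>M i\<in>{1..N}. \<Pi>\<^sub>M k\<in>{1..m}. borel)"

definition entry :: "nat \<Rightarrow> (nat \<Rightarrow> 'a \<Rightarrow> real) \<Rightarrow> 'a \<Rightarrow> nat \<Rightarrow> real" where
  "entry m V \<omega> = (\<lambda>k\<in>{1..m}. V k \<omega>)"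

definition database :: "nat \<Rightarrow> nat \<Rightarrow> (nat \<Rightarrow> nat \<Rightarrow> 'a \<Rightarrow> real) \<Rightarrow> 'a \<Rightarrow> database" where
  "database m N U \<omega> = (\<lambda>i\<in>{1..N}. entry m (U i) \<omega>)"

definition matching_pairs :: "nat \<Rightarrow> labeling \<Rightarrow> labeling \<Rightarrow> (nat \<times> nat) set" where
  "matching_pairs N \<theta>1 \<theta>2 = {(i1, i2) \<in> {1..N} \<times> {1..N}. \<theta>1 i1 = \<theta>2 i2}"


section \<open>The I.I.D. model\<close>

definition labeling_family :: "(nat \<Rightarrow> nat) \<Rightarrow> (nat \<Rightarrow> labeling) \<Rightarrow> bool" where
  "labeling_family n \<Theta> \<longleftrightarrow>
    (\<forall>m\<ge>1. is_labeling (n m) (\<Theta> m)) \<and>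
    (\<forall>m\<ge>1. \<forall>m'\<ge>1. \<forall>i\<in>{1..n m} \<inter> {1..n m'}. i \<le> min m m' \<longrightarrow> \<Theta> m i = \<Theta> m' i)"

text \<open>
  \<open>U1 i k\<close> and \<open>U2 i k\<close> are the \<open>k\<close>-th coordinates of the \<open>i\<close>-th entries of the two databases.
\<close>

definition iid_database_pair ::
  "'a measure \<Rightarrow> (real \<times> real) measure \<Rightarrow> nat \<Rightarrow> nat \<Rightarrow> labeling \<Rightarrow> labeling
    \<Rightarrow> (nat \<Rightarrow> nat \<Rightarrow> 'a \<Rightarrow> real) \<Rightarrow> (nat \<Rightarrow> nat \<Rightarrow> 'a \<Rightarrow> real) \<Rightarrow> bool" where
  "iid_database_pair M P m N \<theta>1 \<theta>2 U1 U2 \<longleftrightarrow>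
    prob_space M \<and>
    prob_space.indep_vars M
      (\<lambda>_. (\<Pi>\<^sub>M k\<in>{1..m}. borel) \<Otimes>\<^sub>M (\<Pi>\<^sub>M k\<in>{1..m}. borel))
      (\<lambda>(i1, i2) \<omega>. (entry m (U1 i1) \<omega>, entry m (U2 i2) \<omega>))
      (matching_pairs N \<theta>1 \<theta>2) \<and>
    (\<forall>(i1, i2)\<in>matching_pairs N \<theta>1 \<theta>2.
      prob_space.indep_vars M (\<lambda>_. borel) (\<lambda>k \<omega>. (U1 i1 k \<omega>, U2 i2 k \<omega>)) {1..m} \<and>
      (\<forall>k\<in>{1..m}. distr M borel (\<lambda>\<omega>. (U1 i1 k \<omega>, U2 i2 k \<omega>)) = P))"

text \<open>
  The probability space and the coordinates may depend on \<open>m\<close>; a single array of coordinates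
  shared by all \<open>m\<close> is the special case of families that are constant in \<open>m\<close>.
\<close>

definition iid_database_family ::
  "(nat \<Rightarrow> 'a measure) \<Rightarrow> (real \<times> real) measure \<Rightarrow> (nat \<Rightarrow> nat)
    \<Rightarrow> (nat \<Rightarrow> labeling) \<Rightarrow> (nat \<Rightarrow> labeling)
    \<Rightarrow> (nat \<Rightarrow> nat \<Rightarrow> nat \<Rightarrow> 'a \<Rightarrow> real) \<Rightarrow> (nat \<Rightarrow> nat \<Rightarrow> nat \<Rightarrow> 'a \<Rightarrow> real) \<Rightarrow> bool" where
  "iid_database_family M P n \<Theta>1 \<Theta>2 U1 U2 \<longleftrightarrow>
    labeling_family n \<Theta>1 \<and> labeling_family n \<Theta>2 \<and>
    (\<forall>m\<ge>1. iid_database_pair (M m) P m (n m) (\<Theta>1 m) (\<Theta>2 m) (U1 m) (U2 m))"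


section \<open>Matching schemes\<close>

text \<open>
  A scheme sees the first database with its labeling and the second database, and returns a
  labeling. Its values have to be measurable for the success probability to make sense.
\<close>

type_synonym scheme = "nat \<Rightarrow> database \<times> labeling \<Rightarrow> database \<Rightarrow> labeling"

definition matching_scheme :: "(nat \<Rightarrow> nat) \<Rightarrow> scheme \<Rightarrow> bool" where
  "matching_scheme n f \<longleftrightarrow>
    (\<forall>m\<ge>1. \<forall>\<theta>. is_labeling (n m) \<theta> \<longrightarrow>
      (\<forall>D1\<in>space (database_space m (n m)). \<forall>D2\<in>space (database_space m (n m)).
        is_labeling (n m) (f m (D1, \<theta>) D2)) \<and>
      (\<forall>i\<in>{1..n m}. (\<lambda>(D1, D2). f m (D1, \<theta>) D2 i)
        \<in> database_space m (n m) \<Otimes>\<^sub>M database_space m (n m) \<rightarrow>\<^sub>M count_space UNIV))"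

text \<open>
  \<open>J\<close> is uniform on \<open>{1..N}\<close> and independent of the databases, hence the product measure.
\<close>

definition success_probability ::
  "'a measure \<Rightarrow> nat \<Rightarrow> nat \<Rightarrow> labeling \<Rightarrow> labeling
    \<Rightarrow> (nat \<Rightarrow> nat \<Rightarrow> 'a \<Rightarrow> real) \<Rightarrow> (nat \<Rightarrow> nat \<Rightarrow> 'a \<Rightarrow> real)
    \<Rightarrow> (database \<times> labeling \<Rightarrow> database \<Rightarrow> labeling) \<Rightarrow> real" where
  "success_probability M m N \<theta>1 \<theta>2 U1 U2 g =
    measure (M \<Otimes>\<^sub>M uniform_count_measure {1..N})
      {(\<omega>, J) \<in> space M \<times> {1..N}.
        g (database m N U1 \<omega>, \<theta>1) (database m N U2 \<omega>) J = \<theta>2 J}"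

definition successful ::
  "scheme \<Rightarrow> (nat \<Rightarrow> 'a measure) \<Rightarrow> (nat \<Rightarrow> nat) \<Rightarrow> (nat \<Rightarrow> labeling) \<Rightarrow> (nat \<Rightarrow> labeling)
    \<Rightarrow> (nat \<Rightarrow> nat \<Rightarrow> nat \<Rightarrow> 'a \<Rightarrow> real) \<Rightarrow> (nat \<Rightarrow> nat \<Rightarrow> nat \<Rightarrow> 'a \<Rightarrow> real) \<Rightarrow> bool" where
  "successful f M n \<Theta>1 \<Theta>2 U1 U2 \<longleftrightarrow>
    (\<lambda>m. success_probability (M m) m (n m) (\<Theta>1 m) (\<Theta>2 m) (U1 m) (U2 m) (f m))
      \<longlonglongrightarrow> 1"

text \<open>
  The labelings are deterministic and the scheme is not given the second one. A scheme chosen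
  after the second labeling could simply output it, so the existence of a scheme is to be
  quantified before the labelings: one scheme for all families with the given sizes and
  distribution.
\<close>

end

theory Submission
  imports Defs "HOL-Real_Asymp.Real_Asymp"
begin

text \<open>
  Let \<open>Q\<close> be the product of the marginals of \<open>P\<close> and \<open>R < t < I\<close>. A truncation of the log-density of
  \<open>P\<close> with respect to \<open>Q\<close> (or, if there is no density, a large multiple of the indicator of a
  \<open>Q\<close>-null set of positive \<open>P\<close>-measure) gives a bounded score \<open>g\<close> with \<open>E\<^sub>Q[2\<^sup>g] \<le> 1\<close> and \<open>E\<^sub>P[g] > t\<close>, as in the
  Donsker-Varadhan formula, also when \<open>I = \<infinity>\<close>. Call a pair of entries plausible if its
  coordinatewise scores add up to more than \<open>m t\<close>. By Hoeffding's inequality a matching pair fails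
  to be plausible with exponentially small probability, and by Markov's inequality a non-matching
  pair, whose entries are independent, is plausible with probability at most \<open>2 powr (- m t)\<close>.
  The scheme copies the labels along the plausible pairs in which each entry is the only plausible
  partner of the other one, and extends this partial injection to a bijection. A union bound over
  the \<open>2 (n\<^sub>m - 1)\<close> possible wrong partners of a matching pair finishes the proof.
\<close>

section \<open>Relative entropy and its Donsker-Varadhan witnesses\<close>

section \<open>Bounded scores\<close>

text \<open>A bounded witness that the Donsker-Varadhan supremum of
  \<open>E_J[g] - log 2 (E_Q[2 powr g])\<close> exceeds \<open>t\<close>, normalized so that the
  logarithmic term is at most 0. Boundedness serves Hoeffding's inequality for matching pairs, the
  exponential moment serves Markov's inequality for the others.\<close>

definition bounded_score :: "'a measure \<Rightarrow> 'a measure \<Rightarrow> real \<Rightarrow> ('a \<Rightarrow> real) \<Rightarrow> bool" where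
  "bounded_score Q J t g \<longleftrightarrow> g \<in> borel_measurable Q \<and> (\<exists>B. \<forall>x. \<bar>g x\<bar> \<le> B) \<and>
    (\<integral>\<^sup>+x. ennreal (2 powr g x) \<partial>Q) \<le> 1 \<and> t < (\<integral>x. g x \<partial>J)"

text \<open>Lowering a score by \<open>log 2 c\<close> divides its exponential moment by
  \<open>c\<close> and costs \<open>log 2 c\<close> in the mean, so a moment bound \<open>c\<close>
  can be traded for the bound 1.\<close>

lemma bounded_score_normalize:
  fixes g :: "'a \<Rightarrow> real"
  assumes "prob_space J" "sets J = sets Q" and g[measurable]: "g \<in> borel_measurable Q"
    and B: "\<And>x. \<bar>g x\<bar> \<le> B" and c: "c > 0" "(\<integral>\<^sup>+x. ennreal (2 powr g x) \<partial>Q) \<le> ennreal c"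
    and t: "t + log 2 c < (\<integral>x. g x \<partial>J)"
  shows "bounded_score Q J t (\<lambda>x. g x - log 2 c)"
proof -
  interpret J: prob_space J by fact
  have "g \<in> borel_measurable J" using g assms(2) by (simp cong: measurable_cong_sets)
  then have int: "integrable J g" using B by (intro J.integrable_const_bound[where B=B]) auto
  have "(\<integral>\<^sup>+x. ennreal (2 powr (g x - log 2 c)) \<partial>Q)
      = (\<integral>\<^sup>+x. ennreal (1 / c) * ennreal (2 powr g x) \<partial>Q)"
    using c by (intro nn_integral_cong) (auto simp: powr_diff ennreal_mult[symmetric])
  also have "\<dots> = ennreal (1 / c) * (\<integral>\<^sup>+x. ennreal (2 powr g x) \<partial>Q)"
    by (rule nn_integral_cmult) simp
  also have "\<dots> \<le> ennreal (1 / c) * ennreal c" by (intro mult_left_mono c) auto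
  also have "\<dots> = 1" using c by (simp add: ennreal_mult[symmetric])
  finally have "(\<integral>\<^sup>+x. ennreal (2 powr (g x - log 2 c)) \<partial>Q) \<le> 1" .
  moreover have "\<exists>B. \<forall>x. \<bar>g x - log 2 c\<bar> \<le> B"
  proof (intro exI allI)
    fix x show "\<bar>g x - log 2 c\<bar> \<le> B + \<bar>log 2 c\<bar>" using B[of x] by linarith
  qed
  moreover have "t < (\<integral>x. g x - log 2 c \<partial>J)" using t int by (simp add: J.prob_space)
  ultimately show ?thesis by (simp add: bounded_score_def)
qed

text \<open>A multiple of the indicator of a \<open>Q\<close>-null set is invisible to
  \<open>Q\<close>, so its exponential moment stays 1, whereas its \<open>J\<close>-mean can be made
  arbitrarily large when the set has positive \<open>J\<close>-measure.\<close>

lemma bounded_score_singular: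
  fixes Q J :: "'a measure"
  assumes Q: "prob_space Q" and J: "prob_space J" and sets: "sets J = sets Q"
    and nac: "\<not> absolutely_continuous Q J"
  shows "\<exists>g. bounded_score Q J t g"
proof -
  interpret Q: prob_space Q by fact
  interpret J: prob_space J by fact
  from nac obtain N where N: "N \<in> null_sets Q" "N \<notin> null_sets J"
    by (auto simp: absolutely_continuous_def)
  have [measurable]: "N \<in> sets Q" "N \<in> sets J" using N sets by (auto dest: null_setsD2)
  have pos: "measure J N > 0" using N sets
    by (auto simp: null_sets_def J.emeasure_eq_measure zero_less_measure_iff)
  \<comment> \<open>Chosen so that the \<open>J\<close>-mean of the score is
    \<open>\<bar>t\<bar> + 1\<close>.\<close>
  define c where "c = (\<bar>t\<bar> + 1) / measure J N"
  have c: "c * measure J N > t" using pos by (simp add: c_def)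
  have "AE x in Q. x \<notin> N" using N(1) by (rule AE_not_in)
  then have "(\<integral>\<^sup>+x. ennreal (2 powr (c * indicator N x)) \<partial>Q) = (\<integral>\<^sup>+x. 1 \<partial>Q)"
    by (intro nn_integral_cong_AE, eventually_elim) simp
  then have "(\<integral>\<^sup>+x. ennreal (2 powr (c * indicator N x)) \<partial>Q) = 1"
    by (simp add: Q.emeasure_space_1)
  moreover have "\<bar>c * indicator N x\<bar> \<le> \<bar>c\<bar>" for x by (auto simp: indicator_def)
  moreover have "(\<integral>x. c * indicator N x \<partial>J) = c * measure J N" by simp
  ultimately show ?thesis using c
    by (intro exI[of _ "\<lambda>x. c * indicator N x"]) (auto simp: bounded_score_def)
qed

text \<open>Replaces the extended-valued Radon-Nikodym derivative by a real, everywhere nonnegative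
  version, so that truncations and logarithms can be taken pointwise.\<close>

lemma prob_density_obtains:
  fixes Q J :: "'a measure"
  assumes Q: "prob_space Q" and J: "prob_space J" and sets: "sets J = sets Q"
    and ac: "absolutely_continuous Q J"
  obtains D where "D \<in> borel_measurable Q" "\<And>x. 0 \<le> D x" "J = density Q (\<lambda>x. ennreal (D x))"
    "(\<integral>\<^sup>+x. ennreal (D x) \<partial>Q) = 1" "AE x in J. 0 < D x"
    "AE x in J. entropy_density b Q J x = log b (D x)"
proof -
  interpret Q: prob_space Q by fact
  interpret J: prob_space J by fact
  obtain D where D: "D \<in> borel_measurable Q" "AE x in Q. RN_deriv Q J x = ennreal (D x)"
    "AE x in J. 0 < D x" "\<And>x. 0 \<le> D x"
    using Q.real_RN_deriv[OF J.finite_measure_axioms ac sets] by metis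
  have dens: "J = density Q (\<lambda>x. ennreal (D x))"
    using Q.density_RN_deriv[OF ac sets] density_cong[OF _ _ D(2)] D(1) by simp
  have "(\<integral>\<^sup>+x. ennreal (D x) \<partial>Q) = emeasure (density Q (\<lambda>x. ennreal (D x))) (space Q)"
    using D(1) by (simp add: emeasure_density cong: nn_integral_cong)
  then have D1: "(\<integral>\<^sup>+x. ennreal (D x) \<partial>Q) = 1"
    using J.emeasure_space_1 sets_eq_imp_space_eq[OF sets] by (simp flip: dens)
  have "AE x in J. RN_deriv Q J x = ennreal (D x)"
    by (rule absolutely_continuous_AE[OF sets ac D(2)])
  then have "AE x in J. entropy_density b Q J x = log b (D x)"
    by eventually_elim (simp add: entropy_density_def D(4))
  then show thesis by (intro that[of D] D dens D1)
qed

text \<open>The optimal score is the log-density itself. Truncations of it are bounded, and as the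
  truncation level grows their \<open>J\<close>-means tend to the relative entropy and their
  exponential moments to 1, so a late enough truncation beats \<open>t\<close>.\<close>

lemma bounded_score_integrable:
  fixes Q J :: "'a measure"
  assumes Q: "prob_space Q" and J: "prob_space J" and sets: "sets J = sets Q"
    and ac: "absolutely_continuous Q J" and int: "integrable J (entropy_density 2 Q J)"
    and t: "t < KL_divergence 2 Q J"
  shows "\<exists>g. bounded_score Q J t g"
proof -
  interpret Q: prob_space Q by fact
  interpret J: prob_space J by fact
  obtain D where D: "D \<in> borel_measurable Q" "\<And>x. 0 \<le> D x" "J = density Q (\<lambda>x. ennreal (D x))"
    "(\<integral>\<^sup>+x. ennreal (D x) \<partial>Q) = 1" "AE x in J. 0 < D x"
    "AE x in J. entropy_density 2 Q J x = log 2 (D x)"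
    by (rule prob_density_obtains[OF Q J sets ac, of 2]) (rule that)
  note [measurable] = D(1)
  have [measurable]: "D \<in> borel_measurable J" using D(1) sets by (simp cong: measurable_cong_sets)
  have intD: "integrable Q D" "(\<integral>x. D x \<partial>Q) = 1"
    using D(1,2,4) by (auto intro!: integrableI_nonneg simp: integral_eq_nn_integral)
  \<comment> \<open>Truncating \<open>D\<close> instead of \<open>log 2 D\<close> avoids the junk value \<open>log 2 0 = 0\<close>.\<close>
  define u where "u K x = max (2 powr - real K) (min (2 powr real K) (D x))" for K x
  have u_meas[measurable]: "u K \<in> borel_measurable Q" "u K \<in> borel_measurable J" for K
    unfolding u_def by measurable
  have u_pos: "u K x > 0" for K x unfolding u_def by (auto simp: less_max_iff_disj)
  have u_lim: "(\<lambda>K. u K x) \<longlonglongrightarrow> D x" for x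
  proof (cases "D x = 0")
    case True
    then have "u K x = 2 powr - real K" for K by (simp add: u_def max_def min_def)
    moreover have "(\<lambda>K. 2 powr - real K) \<longlonglongrightarrow> 0" by real_asymp
    ultimately show ?thesis using True by simp
  next
    case False
    then have "D x > 0" using D(2)[of x] by simp
    have "\<forall>\<^sub>F K in sequentially. 2 powr - real K < D x"
      using \<open>D x > 0\<close> by (intro order_tendstoD(2)[of _ 0]) (real_asymp, simp)
    moreover have "\<forall>\<^sub>F K in sequentially. D x < 2 powr real K"
    proof -
      have "filterlim (\<lambda>K. 2 powr real K) at_top sequentially" by real_asymp
      then show ?thesis by (simp add: filterlim_at_top_dense)
    qed
    ultimately have "\<forall>\<^sub>F K in sequentially. u K x = D x" by eventually_elim (simp add: u_def)
    then show ?thesis by (rule tendsto_eventually)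
  qed
  \<comment> \<open>\<open>D + 1\<close> is the \<open>Q\<close>-integrable majorant for dominated
    convergence.\<close>
  have u_le: "u K x \<le> D x + 1" for K x
  proof -
    have "2 powr - real K \<le> 1" by (simp add: powr_minus_divide ge_one_powr_ge_zero)
    then show ?thesis using D(2)[of x] by (auto simp: u_def)
  qed
  have lim1: "(\<lambda>K. \<integral>x. u K x \<partial>Q) \<longlonglongrightarrow> (\<integral>x. D x \<partial>Q)"
    using u_le u_pos intD u_lim
    by (intro integral_dominated_convergence[where w="\<lambda>x. D x + 1"])
       (auto simp: less_imp_le abs_of_pos)
  have int_u: "integrable Q (u K)" for K
    by (rule Bochner_Integration.integrable_bound[where f="\<lambda>x. D x + 1"])
       (use intD u_le u_pos in \<open>auto intro!: AE_I2 order_trans[OF _ abs_ge_self] simp: less_imp_le\<close>)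
  have log_u: "\<bar>log 2 (u K x)\<bar> \<le> real K" for K x
    using log_le_cancel_iff[of 2 "u K x" "2 powr K"] log_le_cancel_iff[of 2 "2 powr - real K" "u K x"] u_pos[of K x]
    by (auto simp: u_def)
  \<comment> \<open>The truncation interval contains 1, so truncating moves \<open>D x\<close>
    towards 1 and its logarithm towards 0. This makes the entropy density a majorant under
    \<open>J\<close>.\<close>
  have log_u2: "\<bar>log 2 (u K x)\<bar> \<le> \<bar>log 2 (D x)\<bar>" if "D x > 0" for K x
  proof (cases "D x \<ge> 1")
    case True
    have "2 powr - real K \<le> 1" "1 \<le> 2 powr real K" by (auto simp: powr_minus_divide ge_one_powr_ge_zero)
    then have "1 \<le> u K x" "u K x \<le> D x" using True by (auto simp: u_def)
    then show ?thesis using True by simp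
  next
    case False
    have "2 powr - real K \<le> 1" "1 \<le> 2 powr real K" by (auto simp: powr_minus_divide ge_one_powr_ge_zero)
    then have "u K x \<le> 1" "D x \<le> u K x" using False by (auto simp: u_def)
    then show ?thesis using False that u_pos[of K x] by simp
  qed
  have lim2: "(\<lambda>K. \<integral>x. log 2 (u K x) \<partial>J) \<longlonglongrightarrow> (\<integral>x. entropy_density 2 Q J x \<partial>J)"
  proof (rule integral_dominated_convergence[where w="\<lambda>x. \<bar>entropy_density 2 Q J x\<bar>"])
    show "integrable J (\<lambda>x. \<bar>entropy_density 2 Q J x\<bar>)" using int by simp
    show "AE x in J. (\<lambda>K. log 2 (u K x)) \<longlonglongrightarrow> entropy_density 2 Q J x"
      using D(6,5)
    proof eventually_elim
      case (elim x)
      then show ?case by (auto intro!: tendsto_log u_lim)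
    qed
    show "AE x in J. norm (log 2 (u K x)) \<le> \<bar>entropy_density 2 Q J x\<bar>" for K
      using D(6,5) by eventually_elim (use log_u2 in auto)
  qed (use borel_measurable_integrable[OF int] in auto)
  \<comment> \<open>This is the Donsker-Varadhan functional at the score \<open>log 2 (u K)\<close>.
    The subtracted term tends to \<open>log 2 1\<close> because \<open>D\<close> integrates to
    1.\<close>
  have "(\<lambda>K. (\<integral>x. log 2 (u K x) \<partial>J) - log 2 (\<integral>x. u K x \<partial>Q)) \<longlonglongrightarrow> KL_divergence 2 Q J - log 2 1"
    unfolding KL_divergence_def using lim1 lim2 intD by (intro tendsto_intros) auto
  then have "\<forall>\<^sub>F K in sequentially. t < (\<integral>x. log 2 (u K x) \<partial>J) - log 2 (\<integral>x. u K x \<partial>Q)"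
    using t by (intro order_tendstoD) auto
  then obtain K where K: "t + log 2 (\<integral>x. u K x \<partial>Q) < (\<integral>x. log 2 (u K x) \<partial>J)"
    by (auto simp: eventually_sequentially algebra_simps)
  have "0 < (\<integral>x. 2 powr - real K \<partial>Q)" by (simp add: Q.prob_space)
  also have "\<dots> \<le> (\<integral>x. u K x \<partial>Q)" by (intro integral_mono int_u) (auto simp: u_def)
  finally have c: "0 < (\<integral>x. u K x \<partial>Q)" .
  have "(\<integral>\<^sup>+x. ennreal (2 powr log 2 (u K x)) \<partial>Q) = ennreal (\<integral>x. u K x \<partial>Q)"
    using u_pos int_u by (simp add: nn_integral_eq_integral less_imp_le)
  then have "bounded_score Q J t (\<lambda>x. log 2 (u K x) - log 2 (\<integral>x. u K x \<partial>Q))"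
    by (intro bounded_score_normalize[OF J sets _ log_u c _ K]) auto
  then show ?thesis by blast
qed

text \<open>
  Here the relative entropy is \<open>\<infinity>\<close>: the negative part of \<open>log 2 D\<close> is always \<open>J\<close>-integrable since
  \<open>- x ln x\<close> is bounded on \<open>[0, 1]\<close>, so the scores \<open>log 2 (u K)\<close> below have unbounded means.
\<close>

lemma bounded_score_not_integrable:
  fixes Q J :: "'a measure"
  assumes Q: "prob_space Q" and J: "prob_space J" and sets: "sets J = sets Q"
    and ac: "absolutely_continuous Q J" and nint: "\<not> integrable J (entropy_density 2 Q J)"
  shows "\<exists>g. bounded_score Q J t g"
proof -
  interpret Q: prob_space Q by fact
  interpret J: prob_space J by fact
  obtain D where D: "D \<in> borel_measurable Q" "\<And>x. 0 \<le> D x" "J = density Q (\<lambda>x. ennreal (D x))"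
    "(\<integral>\<^sup>+x. ennreal (D x) \<partial>Q) = 1" "AE x in J. 0 < D x"
    "AE x in J. entropy_density 2 Q J x = log 2 (D x)"
    by (rule prob_density_obtains[OF Q J sets ac, of 2]) (rule that)
  note [measurable] = D(1)
  have [measurable]: "D \<in> borel_measurable J" using D(1) sets by (simp cong: measurable_cong_sets)
  \<comment> \<open>Cutting off below at 1 keeps only the positive part of the log-density: the
    scores are nonnegative and increase with \<open>K\<close>, and \<open>u K \<le> 1 + D\<close>
    bounds every exponential moment by 2.\<close>
  define u where "u K x = max 1 (min (2 powr real K) (D x))" for K x
  have u_meas[measurable]: "u K \<in> borel_measurable Q" "u K \<in> borel_measurable J" for K
    unfolding u_def by measurable
  have u_ge: "u K x \<ge> 1" for K x by (simp add: u_def)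
  have log_u: "0 \<le> log 2 (u K x)" "log 2 (u K x) \<le> real K" for K x
    using log_le_cancel_iff[of 2 "u K x" "2 powr K"] u_ge[of K x] by (auto simp: u_def ge_one_powr_ge_zero)
  have int_log: "integrable J (\<lambda>x. log 2 (u K x))" for K
    using log_u by (intro J.integrable_const_bound[where B="real K"]) auto
  have pow: "(\<integral>\<^sup>+x. ennreal (2 powr log 2 (u K x)) \<partial>Q) \<le> ennreal 2" for K
  proof -
    have "(\<integral>\<^sup>+x. ennreal (2 powr log 2 (u K x)) \<partial>Q) \<le> (\<integral>\<^sup>+x. 1 + ennreal (D x) \<partial>Q)"
    proof (intro nn_integral_mono)
      fix x
      have "2 powr log 2 (u K x) \<le> 1 + D x" using u_ge[of K x] D(2)[of x] by (auto simp: u_def)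
      then show "ennreal (2 powr log 2 (u K x)) \<le> 1 + ennreal (D x)"
        using D(2)[of x] by (metis ennreal_1 ennreal_leI ennreal_plus zero_le_one)
    qed
    also have "\<dots> = 2" using D(4) by (simp add: nn_integral_add Q.emeasure_space_1 one_add_one)
    finally show ?thesis by simp
  qed
  \<comment> \<open>The extra \<open>log 2 2\<close> pays for normalizing the moment bound 2. If all
    means stayed below this level, both the positive and the negative part of the log-density would
    be \<open>J\<close>-integrable.\<close>
  have "\<exists>K. t + log 2 2 < (\<integral>x. log 2 (u K x) \<partial>J)"
  proof (rule ccontr)
    assume "\<not> ?thesis"
    then have bd: "(\<integral>x. log 2 (u K x) \<partial>J) \<le> t + 1" for K by (simp add: not_less)
    \<comment> \<open>At each \<open>x\<close> the upper cut-off is inactive for large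
      \<open>K\<close>, so the positive part is the increasing limit of the scores and inherits the
      bound on their means by monotone convergence.\<close>
    have "(\<integral>\<^sup>+x. ennreal (log 2 (max 1 (D x))) \<partial>J) = (\<integral>\<^sup>+x. (SUP K. ennreal (log 2 (u K x))) \<partial>J)"
    proof (intro nn_integral_cong antisym SUP_least)
      fix x
      obtain K :: nat where "real K \<ge> log 2 (max 1 (D x))" using real_arch_simple by blast
      then have "max 1 (D x) \<le> 2 powr real K" by (subst (asm) log_le_iff) auto
      then have "u K x = max 1 (D x)" by (auto simp: u_def)
      then show "ennreal (log 2 (max 1 (D x))) \<le> (SUP K. ennreal (log 2 (u K x)))"
        by (intro SUP_upper2[of K]) auto
      fix K show "ennreal (log 2 (u K x)) \<le> ennreal (log 2 (max 1 (D x)))"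
        by (intro ennreal_leI) (auto simp: u_def)
    qed
    also have "\<dots> = (SUP K. \<integral>\<^sup>+x. ennreal (log 2 (u K x)) \<partial>J)"
    proof (rule nn_integral_monotone_convergence_SUP)
      show "incseq (\<lambda>K x. ennreal (log 2 (u K x)))"
      proof (intro incseq_SucI le_funI ennreal_leI)
        fix K x
        have "2 powr real K \<le> 2 powr real (Suc K)" by (intro powr_mono) auto
        then have "u K x \<le> u (Suc K) x" unfolding u_def by (intro max.mono min.mono) auto
        then show "log 2 (u K x) \<le> log 2 (u (Suc K) x)" using u_ge[of K x] by simp
      qed
    qed simp
    also have "\<dots> \<le> ennreal (t + 1)"
      using bd log_u int_log
      by (intro SUP_least) (simp add: nn_integral_eq_integral ennreal_leI)
    finally have pos: "integrable J (\<lambda>x. log 2 (max 1 (D x)))"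
      by (intro integrableI_nonneg) (auto intro: le_less_trans)
    \<comment> \<open>Passing from \<open>J\<close> to \<open>Q\<close> brings in a factor
      \<open>D x\<close>. Then \<open>- d * ln d \<le> 1\<close> for \<open>0 < d < 1\<close>, by
      \<open>ln y \<le> y - 1\<close> at \<open>y = 1 / d\<close>; at \<open>D x = 0\<close> the
      factor kills the integrand.\<close>
    have "(\<integral>\<^sup>+x. ennreal (- log 2 (min 1 (D x))) \<partial>J)
        = (\<integral>\<^sup>+x. ennreal (D x) * ennreal (- log 2 (min 1 (D x))) \<partial>Q)"
      by (subst D(3), subst nn_integral_density) auto
    also have "\<dots> \<le> (\<integral>\<^sup>+x. ennreal (1 / ln 2) \<partial>Q)"
    proof (intro nn_integral_mono)
      fix x
      have "D x * (- log 2 (min 1 (D x))) \<le> 1 / ln 2"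
      proof (cases "D x = 0 \<or> D x \<ge> 1")
        case False
        then have d: "0 < D x" "D x < 1" using D(2)[of x] by auto
        have "- ln (D x) \<le> 1 / D x - 1" using ln_le_minus_one[of "1 / D x"] d by (simp add: ln_div)
        then have "D x * (- ln (D x)) \<le> D x * (1 / D x - 1)" using d by (intro mult_left_mono) auto
        also have "\<dots> \<le> 1" using d by (simp add: algebra_simps)
        finally show ?thesis using d by (simp add: log_def divide_simps)
      qed (auto simp: min_def)
      then show "ennreal (D x) * ennreal (- log 2 (min 1 (D x))) \<le> ennreal (1 / ln 2)"
        using D(2)[of x] by (simp add: ennreal_mult'[symmetric] ennreal_leI)
    qed
    also have "\<dots> < \<infinity>" by (simp add: Q.emeasure_space_1)
    finally have "integrable J (\<lambda>x. - log 2 (min 1 (D x)))"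
      using D(5) by (intro integrableI_nonneg) (auto elim!: eventually_mono simp: min_def)
    with pos have "integrable J (\<lambda>x. log 2 (max 1 (D x)) - (- log 2 (min 1 (D x))))"
      by (rule Bochner_Integration.integrable_diff)
    moreover have "entropy_density 2 Q J \<in> borel_measurable J"
      using measurable_entropy_density[of 2 Q J] sets by (simp cong: measurable_cong_sets)
    ultimately have "integrable J (entropy_density 2 Q J)"
      by (rule integrable_cong_AE_imp) (use D(6,5) in \<open>eventually_elim, auto simp: max_def min_def\<close>)
    with nint show False by simp
  qed
  then obtain K where K: "t + log 2 2 < (\<integral>x. log 2 (u K x) \<partial>J)" by blast
  have "bounded_score Q J t (\<lambda>x. log 2 (u K x) - log 2 2)"
    by (intro bounded_score_normalize[OF J sets _ _ _ pow K, where B="real K"]) (use log_u in auto)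
  then show ?thesis by blast
qed

section \<open>Exponential inequalities for independent and for matching entries\<close>

section \<open>Tail bounds for sums of scores\<close>

text \<open>Regroups a pair of vectors as a vector of pairs: Tonelli separates the two vectors, the
  product formula is applied to each in turn, and Tonelli rejoins the factors
  coordinatewise.\<close>

lemma nn_integral_prod_PiM_pair:
  fixes f :: "'i \<Rightarrow> 'a \<times> 'b \<Rightarrow> ennreal"
  assumes "\<And>k. prob_space (P1 k)" "\<And>k. prob_space (P2 k)" and I: "finite I"
    and f: "\<And>k. k \<in> I \<Longrightarrow> f k \<in> borel_measurable (P1 k \<Otimes>\<^sub>M P2 k)"
  shows "(\<integral>\<^sup>+z. (\<Prod>k\<in>I. f k (fst z k, snd z k)) \<partial>(Pi\<^sub>M I P1 \<Otimes>\<^sub>M Pi\<^sub>M I P2))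
    = (\<Prod>k\<in>I. \<integral>\<^sup>+z. f k z \<partial>(P1 k \<Otimes>\<^sub>M P2 k))"
proof -
  interpret P1: product_prob_space P1 by (simp add: product_prob_space_def product_sigma_finite_def
      product_prob_space_axioms_def assms prob_space_imp_sigma_finite)
  interpret P2: product_prob_space P2 by (simp add: product_prob_space_def product_sigma_finite_def
      product_prob_space_axioms_def assms prob_space_imp_sigma_finite)
  have Y: "sigma_finite_measure (Pi\<^sub>M I P2)"
    by (intro prob_space_imp_sigma_finite prob_space_PiM assms)
  have P2': "sigma_finite_measure (P2 k)" for k by (intro prob_space_imp_sigma_finite assms)
  have meas: "(\<lambda>z. \<Prod>k\<in>I. f k (fst z k, snd z k)) \<in> borel_measurable (Pi\<^sub>M I P1 \<Otimes>\<^sub>M Pi\<^sub>M I P2)"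
  proof (rule borel_measurable_prod_ennreal)
    fix k assume "k \<in> I"
    note [measurable] = f[OF this] \<open>k \<in> I\<close>
    show "(\<lambda>z. f k (fst z k, snd z k)) \<in> borel_measurable (Pi\<^sub>M I P1 \<Otimes>\<^sub>M Pi\<^sub>M I P2)" by measurable
  qed
  have "(\<integral>\<^sup>+z. (\<Prod>k\<in>I. f k (fst z k, snd z k)) \<partial>(Pi\<^sub>M I P1 \<Otimes>\<^sub>M Pi\<^sub>M I P2))
    = (\<integral>\<^sup>+x. \<integral>\<^sup>+y. (\<Prod>k\<in>I. f k (x k, y k)) \<partial>Pi\<^sub>M I P2 \<partial>Pi\<^sub>M I P1)"
    using sigma_finite_measure.nn_integral_fst[OF Y meas] by simp
  also have "\<dots> = (\<integral>\<^sup>+x. (\<Prod>k\<in>I. \<integral>\<^sup>+y. f k (x k, y) \<partial>P2 k) \<partial>Pi\<^sub>M I P1)"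
  proof (intro nn_integral_cong P2.product_nn_integral_prod I)
    fix x k assume x: "x \<in> space (Pi\<^sub>M I P1)" and k: "k \<in> I"
    then have "x k \<in> space (P1 k)" by (auto simp: space_PiM)
    then show "(\<lambda>y. f k (x k, y)) \<in> borel_measurable (P2 k)"
      using measurable_compose[OF measurable_Pair1' f[OF k]] by simp
  qed
  also have "\<dots> = (\<Prod>k\<in>I. \<integral>\<^sup>+x. \<integral>\<^sup>+y. f k (x, y) \<partial>P2 k \<partial>P1 k)"
    by (intro P1.product_nn_integral_prod I sigma_finite_measure.borel_measurable_nn_integral_fst[OF P2'] f)
  also have "\<dots> = (\<Prod>k\<in>I. \<integral>\<^sup>+z. f k z \<partial>(P1 k \<Otimes>\<^sub>M P2 k))"
    by (intro prod.cong refl sigma_finite_measure.nn_integral_fst[OF P2'] f)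
  finally show ?thesis .
qed

text \<open>By independence within and between the vectors, the exponential moment of the sum is the
  product of the coordinatewise moments, each at most 1; Markov's inequality for 2 to the power of
  the sum then gives the bound.\<close>

lemma (in prob_space) prob_score_sum_independent:
  fixes X Y :: "'i \<Rightarrow> 'a \<Rightarrow> real" and g :: "real \<times> real \<Rightarrow> real"
  assumes I: "finite I" "I \<noteq> {}"
    and X: "indep_vars (\<lambda>_. borel) X I" "\<And>k. k \<in> I \<Longrightarrow> distr M borel (X k) = P1"
    and Y: "indep_vars (\<lambda>_. borel) Y I" "\<And>k. k \<in> I \<Longrightarrow> distr M borel (Y k) = P2"
    and XY: "indep_var (\<Pi>\<^sub>M k\<in>I. borel) (\<lambda>\<omega>. \<lambda>k\<in>I. X k \<omega>) (\<Pi>\<^sub>M k\<in>I. borel) (\<lambda>\<omega>. \<lambda>k\<in>I. Y k \<omega>)"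
    and g[measurable]: "g \<in> borel_measurable borel"
    and le_1: "(\<integral>\<^sup>+z. ennreal (2 powr g z) \<partial>(P1 \<Otimes>\<^sub>M P2)) \<le> 1"
  shows "prob {\<omega>\<in>space M. a < (\<Sum>k\<in>I. g (X k \<omega>, Y k \<omega>))} \<le> 2 powr - a"
proof -
  have [measurable]: "X k \<in> borel_measurable M" "Y k \<in> borel_measurable M" if "k \<in> I" for k
    using X(1) Y(1) that by (auto simp: indep_vars_def)
  obtain k0 where k0: "k0 \<in> I" using I by blast
  have P1: "prob_space P1" "sets P1 = sets borel" and P2: "prob_space P2" "sets P2 = sets borel"
    using X(2)[OF k0] Y(2)[OF k0] k0 by (auto intro!: prob_space_distr)
  have [measurable_cong]: "sets P1 = sets borel" "sets P2 = sets borel" by fact+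
  have g': "g \<in> borel_measurable (P1 \<Otimes>\<^sub>M P2)" using P1 P2 g
    by (simp add: borel_prod[symmetric] cong: measurable_cong_sets sets_pair_measure_cong)
  have dX: "distr M (\<Pi>\<^sub>M k\<in>I. borel) (\<lambda>\<omega>. \<lambda>k\<in>I. X k \<omega>) = (\<Pi>\<^sub>M k\<in>I. P1)"
    using X I by (subst (asm) indep_vars_iff_distr_eq_PiM') (auto cong: PiM_cong)
  have dY: "distr M (\<Pi>\<^sub>M k\<in>I. borel) (\<lambda>\<omega>. \<lambda>k\<in>I. Y k \<omega>) = (\<Pi>\<^sub>M k\<in>I. P2)"
    using Y I by (subst (asm) indep_vars_iff_distr_eq_PiM') (auto cong: PiM_cong)
  let ?Z = "\<lambda>\<omega>. (\<lambda>k\<in>I. X k \<omega>, \<lambda>k\<in>I. Y k \<omega>)"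
  have Z: "distr M ((\<Pi>\<^sub>M k\<in>I. borel) \<Otimes>\<^sub>M (\<Pi>\<^sub>M k\<in>I. borel)) ?Z = (\<Pi>\<^sub>M k\<in>I. P1) \<Otimes>\<^sub>M (\<Pi>\<^sub>M k\<in>I. P2)"
    using XY by (simp add: indep_var_distribution_eq dX dY)
  have gk: "(\<lambda>z. g (fst z k, snd z k)) \<in> borel_measurable ((\<Pi>\<^sub>M k\<in>I. borel) \<Otimes>\<^sub>M (\<Pi>\<^sub>M k\<in>I. borel))"
    if [measurable]: "k \<in> I" for k by measurable
  have gM[measurable]: "(\<lambda>\<omega>. g (X k \<omega>, Y k \<omega>)) \<in> borel_measurable M"
    if [measurable]: "k \<in> I" for k by measurable
  \<comment> \<open>The Chernoff parameter is \<open>ln 2\<close>, which turns the exponential into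
    a power of 2.\<close>
  have "(\<integral>\<^sup>+\<omega>. ennreal (exp (ln 2 * (\<Sum>k\<in>I. g (X k \<omega>, Y k \<omega>)))) \<partial>M)
      = (\<integral>\<^sup>+\<omega>. (\<Prod>k\<in>I. ennreal (2 powr g (X k \<omega>, Y k \<omega>))) \<partial>M)"
    by (intro nn_integral_cong) (simp add: prod_ennreal powr_def sum_distrib_left exp_sum I mult.commute)
  also have "\<dots> = (\<integral>\<^sup>+\<omega>. (\<Prod>k\<in>I. ennreal (2 powr g (fst (?Z \<omega>) k, snd (?Z \<omega>) k))) \<partial>M)"
    by (intro nn_integral_cong prod.cong) auto
  also have "\<dots> = (\<integral>\<^sup>+z. (\<Prod>k\<in>I. ennreal (2 powr g (fst z k, snd z k))) \<partial>
      distr M ((\<Pi>\<^sub>M k\<in>I. borel) \<Otimes>\<^sub>M (\<Pi>\<^sub>M k\<in>I. borel)) ?Z)"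
    using gk by (subst nn_integral_distr)
      (auto intro!: borel_measurable_prod_ennreal measurable_Pair measurable_restrict)
  also have "\<dots> = (\<Prod>k\<in>I. \<integral>\<^sup>+z. ennreal (2 powr g z) \<partial>(P1 \<Otimes>\<^sub>M P2))"
    unfolding Z by (rule nn_integral_prod_PiM_pair) (use P1 P2 I g' in auto)
  also have "\<dots> \<le> 1" by (rule prod_le_1) (use le_1 in auto)
  finally have le: "(\<integral>\<^sup>+\<omega>. ennreal (exp (ln 2 * (\<Sum>k\<in>I. g (X k \<omega>, Y k \<omega>)))) \<partial>M) \<le> 1" .
  have "ennreal (prob {\<omega>\<in>space M. a < (\<Sum>k\<in>I. g (X k \<omega>, Y k \<omega>))})
      \<le> emeasure M {\<omega>\<in>space M. (\<Sum>k\<in>I. g (X k \<omega>, Y k \<omega>)) \<ge> a}"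
    unfolding emeasure_eq_measure[symmetric] by (intro emeasure_mono) auto
  also have "\<dots> \<le> ennreal (exp (- ln 2 * a)) *
      (\<integral>\<^sup>+\<omega>\<in>space M. ennreal (exp (ln 2 * (\<Sum>k\<in>I. g (X k \<omega>, Y k \<omega>)))) \<partial>M)"
    by (rule Chernoff_ineq_nn_integral_ge) auto
  also have "(\<integral>\<^sup>+\<omega>\<in>space M. ennreal (exp (ln 2 * (\<Sum>k\<in>I. g (X k \<omega>, Y k \<omega>)))) \<partial>M)
      = (\<integral>\<^sup>+\<omega>. ennreal (exp (ln 2 * (\<Sum>k\<in>I. g (X k \<omega>, Y k \<omega>)))) \<partial>M)"
    by (intro nn_integral_cong) auto
  also have "ennreal (exp (- ln 2 * a)) * \<dots> \<le> ennreal (exp (- ln 2 * a)) * 1"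
    by (intro mult_left_mono le) auto
  also have "\<dots> = ennreal (2 powr - a)" by (simp add: powr_def mult.commute)
  finally show ?thesis by simp
qed

text \<open>Hoeffding's inequality for i.i.d. values in \<open>{- B..B}\<close>, an interval of
  length \<open>2 * B\<close>. The deviation of the sum is \<open>card I\<close> times the gap
  between the mean and \<open>t\<close>.\<close>

lemma (in prob_space) prob_score_sum_matched:
  fixes Z :: "'i \<Rightarrow> 'a \<Rightarrow> 'b::topological_space" and g :: "'b \<Rightarrow> real" and t :: real
  assumes I: "finite I" "I \<noteq> {}"
    and Z: "indep_vars (\<lambda>_. borel) Z I" "\<And>k. k \<in> I \<Longrightarrow> distr M borel (Z k) = P"
    and g[measurable]: "g \<in> borel_measurable borel" and B: "\<And>z. \<bar>g z\<bar> \<le> B" "B > 0"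
    and t: "t \<le> (\<integral>z. g z \<partial>P)"
  shows "prob {\<omega>\<in>space M. (\<Sum>k\<in>I. g (Z k \<omega>)) \<le> card I * t}
    \<le> exp (- real (card I) * ((\<integral>z. g z \<partial>P) - t)\<^sup>2 / (2 * B\<^sup>2))"
proof -
  obtain k0 where k0: "k0 \<in> I" using I by blast
  have Zm[measurable]: "Z k \<in> borel_measurable M" if "k \<in> I" for k
    using Z(1) that by (auto simp: indep_vars_def)
  have distr: "distr M borel (\<lambda>\<omega>. g (Z k \<omega>)) = distr P borel g" if "k \<in> I" for k
    using that by (simp flip: Z(2)[OF that] add: distr_distr comp_def)
  have bd: "g z \<in> {- B..B}" for z using B(1)[of z] by auto
  interpret iid_interval_bounded_random_variables M I "\<lambda>k \<omega>. g (Z k \<omega>)" "\<lambda>\<omega>. g (Z k0 \<omega>)" "- B" B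
  proof
    show "indep_vars (\<lambda>_. borel) (\<lambda>k \<omega>. g (Z k \<omega>)) I"
      by (rule indep_vars_compose2[OF Z(1)]) simp
  qed (use I distr k0 bd in auto)
  define e where "e = (\<integral>z. g z \<partial>P)"
  have e: "expectation (\<lambda>\<omega>. g (Z k0 \<omega>)) = e"
    using k0 by (simp add: e_def flip: Z(2)[OF k0] integral_distr[OF Zm[OF k0] g])
  interpret Hoeffding_ineq_iid M I "\<lambda>k \<omega>. g (Z k \<omega>)" "\<lambda>\<omega>. g (Z k0 \<omega>)" "- B" B e
    by unfold_locales (simp add: e)
  have n: "card I > 0" using I by (simp add: card_gt_0_iff)
  have "prob {\<omega>\<in>space M. (\<Sum>k\<in>I. g (Z k \<omega>)) \<le> card I * e - card I * (e - t)}
    \<le> exp (- 2 * (card I * (e - t))\<^sup>2 / (card I * (B - (- B))\<^sup>2))"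
    by (rule Hoeffding_ineq_le) (use t B I in \<open>auto simp: e_def\<close>)
  moreover have "card I * e - card I * (e - t) = card I * t" by (simp add: algebra_simps)
  moreover have "- 2 * (card I * (e - t))\<^sup>2 / (card I * (B - (- B))\<^sup>2)
      = - real (card I) * (e - t)\<^sup>2 / (2 * B\<^sup>2)"
    using n B by (simp add: field_simps power2_eq_square)
  ultimately show ?thesis by (simp add: e_def)
qed

lemma (in prob_space) prob_finite_UN_le:
  fixes c :: real
  assumes "finite I" "\<And>i. i \<in> I \<Longrightarrow> A i \<in> events" "\<And>i. i \<in> I \<Longrightarrow> prob (A i) \<le> c"
  shows "prob (\<Union>i\<in>I. A i) \<le> card I * c"
proof -
  have "prob (\<Union>i\<in>I. A i) \<le> (\<Sum>i\<in>I. prob (A i))"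
    using assms by (intro finite_measure_subadditive_finite) auto
  also have "\<dots> \<le> (\<Sum>i\<in>I. c)" by (intro sum_mono assms)
  finally show ?thesis by simp
qed

section \<open>Isolated edges of a bipartite graph and their completion to a labeling\<close>

section \<open>The scheme\<close>

lemma partial_matching_extends:
  assumes \<theta>: "is_labeling N \<theta>" and G: "G \<subseteq> {1..N} \<times> {1..N}"
    and inj: "\<And>i j i' j'. (i, j) \<in> G \<Longrightarrow> (i', j') \<in> G \<Longrightarrow> i = i' \<longleftrightarrow> j = j'"
  shows "\<exists>\<phi>. is_labeling N \<phi> \<and> (\<forall>(i, j)\<in>G. \<phi> j = \<theta> i)"
proof -
  \<comment> \<open>On indices covered by \<open>G\<close> the partner is unique; elsewhere the
    value is arbitrary and is replaced by \<open>k\<close> below.\<close>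
  define h where "h j = \<theta> (THE i. (i, j) \<in> G)" for j
  have h: "h j = \<theta> i" if "(i, j) \<in> G" for i j
    unfolding h_def using that inj[OF _ that] by (intro arg_cong[of _ _ \<theta>] the_equality) blast+
  define B where "B = snd ` G"
  have B: "B \<subseteq> {1..N}" using G by (auto simp: B_def)
  have hB: "h ` B \<subseteq> {1..N}"
  proof safe
    fix x assume "x \<in> B"
    then obtain i where "(i, x) \<in> G" by (auto simp: B_def)
    then have "i \<in> {1..N}" "h x = \<theta> i" using G h[of i x] by auto
    then show "h x \<in> {1..N}" using bij_betwE[OF \<theta>[unfolded is_labeling_def]] by metis
  qed
  have "inj_on h B"
  proof (rule inj_onI)
    fix x y assume "x \<in> B" "y \<in> B" "h x = h y"
    then obtain i j where ij: "(i, x) \<in> G" "(j, y) \<in> G" by (auto simp: B_def)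
    then have "\<theta> i = \<theta> j" using h[of i x] h[of j y] \<open>h x = h y\<close> by simp
    moreover have "i \<in> {1..N}" "j \<in> {1..N}" using ij G by auto
    ultimately have "i = j" using \<theta> by (auto simp: is_labeling_def bij_betw_def dest: inj_onD)
    then show "x = y" using inj ij by blast
  qed
  then have bij: "bij_betw h B (h ` B)" by (rule inj_on_imp_bij_betw)
  have "card ({1..N} - B) = card ({1..N} - h ` B)"
    using card_Diff_subset[OF finite_subset[OF B] B] card_Diff_subset[OF finite_subset[OF hB] hB]
      card_image[OF \<open>inj_on h B\<close>] by simp
  then obtain k where k: "bij_betw k ({1..N} - B) ({1..N} - h ` B)"
    using finite_same_card_bij[of "{1..N} - B" "{1..N} - h ` B"] by auto
  have "bij_betw (\<lambda>x. if x \<in> B then h x else k x) (B \<union> ({1..N} - B)) (h ` B \<union> ({1..N} - h ` B))"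
    by (rule bij_betw_disjoint_Un[OF bij k]) auto
  moreover have "B \<union> ({1..N} - B) = {1..N}" "h ` B \<union> ({1..N} - h ` B) = {1..N}"
    using B hB by auto
  ultimately have "is_labeling N (\<lambda>x. if x \<in> B then h x else k x)" by (simp add: is_labeling_def)
  moreover have "\<forall>(i, j)\<in>G. (if j \<in> B then h j else k j) = \<theta> i"
  proof safe
    fix i j assume ij: "(i, j) \<in> G"
    then have "j \<in> B" unfolding B_def by (rule image_eqI[rotated]) simp
    then show "(if j \<in> B then h j else k j) = \<theta> i" using h[OF ij] by simp
  qed
  ultimately show ?thesis by blast
qed

text \<open>The isolated edges of \<open>S\<close>, seen as a bipartite graph. Uniqueness on both
  sides makes them a partial injection whatever \<open>S\<close> is, so that a completion always
  exists.\<close>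

definition mutual_matches :: "nat \<Rightarrow> (nat \<times> nat) set \<Rightarrow> (nat \<times> nat) set" where
  "mutual_matches N S = {(i, j) \<in> S \<inter> {1..N} \<times> {1..N}.
    (\<forall>i'\<in>{1..N}. (i', j) \<in> S \<longrightarrow> i' = i) \<and> (\<forall>j'\<in>{1..N}. (i, j') \<in> S \<longrightarrow> j' = j)}"

text \<open>The arbitrary choice depends on the databases only through the set \<open>S\<close>,
  which has finitely many possible values; this keeps the scheme measurable.\<close>

definition complete_labeling :: "nat \<Rightarrow> labeling \<Rightarrow> (nat \<times> nat) set \<Rightarrow> labeling" where
  "complete_labeling N \<theta> S =
    (SOME \<phi>. is_labeling N \<phi> \<and> (\<forall>(i, j)\<in>mutual_matches N S. \<phi> j = \<theta> i))"

lemma complete_labeling: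
  assumes "is_labeling N \<theta>"
  shows "is_labeling N (complete_labeling N \<theta> S)"
    and "(i, j) \<in> mutual_matches N S \<Longrightarrow> complete_labeling N \<theta> S j = \<theta> i"
proof -
  have "\<exists>\<phi>. is_labeling N \<phi> \<and> (\<forall>(i, j)\<in>mutual_matches N S. \<phi> j = \<theta> i)"
  proof (rule partial_matching_extends[OF assms])
    show "mutual_matches N S \<subseteq> {1..N} \<times> {1..N}" unfolding mutual_matches_def by blast
    fix i j i' j' assume "(i, j) \<in> mutual_matches N S" "(i', j') \<in> mutual_matches N S"
    then show "i = i' \<longleftrightarrow> j = j'" unfolding mutual_matches_def by blast
  qed
  note * = someI_ex[OF this, folded complete_labeling_def]
  show "is_labeling N (complete_labeling N \<theta> S)"
    and "(i, j) \<in> mutual_matches N S \<Longrightarrow> complete_labeling N \<theta> S j = \<theta> i"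
    using * by blast+
qed

definition score_matches ::
  "(real \<times> real \<Rightarrow> real) \<Rightarrow> real \<Rightarrow> nat \<Rightarrow> nat \<Rightarrow> database \<Rightarrow> database \<Rightarrow> (nat \<times> nat) set" where
  "score_matches g t m N D1 D2 =
    {(i, j) \<in> {1..N} \<times> {1..N}. real m * t < (\<Sum>k\<in>{1..m}. g (D1 i k, D2 j k))}"

definition score_scheme :: "(real \<times> real \<Rightarrow> real) \<Rightarrow> real \<Rightarrow> (nat \<Rightarrow> nat) \<Rightarrow> scheme" where
  "score_scheme g t n m = (\<lambda>(D1, \<theta>) D2. complete_labeling (n m) \<theta> (score_matches g t m (n m) D1 D2))"

section \<open>Measurability of the scheme\<close>

lemma score_matches_subset: "score_matches g t m N D1 D2 \<subseteq> {1..N} \<times> {1..N}"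
  by (auto simp: score_matches_def)

text \<open>The target is finite, so it suffices to treat the preimage of a single set, which is cut
  out by finitely many threshold conditions on sums of measurable scores.\<close>

lemma measurable_score_matches:
  assumes [measurable]: "g \<in> borel_measurable borel"
  shows "(\<lambda>(D1, D2). score_matches g t m N D1 D2)
    \<in> database_space m N \<Otimes>\<^sub>M database_space m N \<rightarrow>\<^sub>M count_space (Pow ({1..N} \<times> {1..N}))"
proof (subst measurable_count_space_eq2, simp, safe)
  let ?DB = "database_space m N \<Otimes>\<^sub>M database_space m N"
  fix S :: "(nat \<times> nat) set" assume S: "S \<subseteq> {1..N} \<times> {1..N}"
  have comp: "(\<lambda>D. D i k) \<in> borel_measurable (database_space m N)"
    if "i \<in> {1..N}" "k \<in> {1..m}" for i k
  proof -
    have "(\<lambda>D. D i) \<in> database_space m N \<rightarrow>\<^sub>M (\<Pi>\<^sub>M k\<in>{1..m}. borel)"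
      unfolding database_space_def by (rule measurable_component_singleton[OF that(1)])
    from measurable_compose[OF this measurable_component_singleton[OF that(2)]] show ?thesis .
  qed
  have P: "Measurable.pred ?DB (\<lambda>z. (i, j) \<in> S \<longleftrightarrow>
      real m * t < (\<Sum>k\<in>{1..m}. g (fst z i k, snd z j k)))"
    if "i \<in> {1..N}" "j \<in> {1..N}" for i j
  proof -
    have [measurable]: "(\<lambda>z. (\<Sum>k\<in>{1..m}. g (fst z i k, snd z j k))) \<in> borel_measurable ?DB"
    proof (rule borel_measurable_sum)
      fix k assume k: "k \<in> {1..m}"
      have [measurable]: "(\<lambda>z. fst z i k) \<in> borel_measurable ?DB" "(\<lambda>z. snd z j k) \<in> borel_measurable ?DB"
        using measurable_compose[OF measurable_fst comp[OF that(1) k]]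
          measurable_compose[OF measurable_snd comp[OF that(2) k]] by auto
      show "(\<lambda>z. g (fst z i k, snd z j k)) \<in> borel_measurable ?DB" by measurable
    qed
    show ?thesis by measurable
  qed
  have pred: "Measurable.pred ?DB (\<lambda>z. \<forall>i\<in>{1..N}. \<forall>j\<in>{1..N}. (i, j) \<in> S \<longleftrightarrow>
      real m * t < (\<Sum>k\<in>{1..m}. g (fst z i k, snd z j k)))"
    by (intro pred_intros_finite finite_atLeastAtMost P)
  have mem: "score_matches g t m N D1 D2 = S \<longleftrightarrow> (\<forall>i\<in>{1..N}. \<forall>j\<in>{1..N}. (i, j) \<in> S \<longleftrightarrow>
      real m * t < (\<Sum>k\<in>{1..m}. g (D1 i k, D2 j k)))" for D1 D2
  proof -
    have "A = S \<longleftrightarrow> (\<forall>p\<in>T. p \<in> S \<longleftrightarrow> p \<in> A)" if "A \<subseteq> T" "S \<subseteq> T" for A T :: "(nat \<times> nat) set"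
      using that by blast
    from this[OF score_matches_subset S] have "score_matches g t m N D1 D2 = S \<longleftrightarrow>
        (\<forall>p\<in>{1..N} \<times> {1..N}. p \<in> S \<longleftrightarrow> p \<in> score_matches g t m N D1 D2)" .
    also have "\<dots> \<longleftrightarrow> (\<forall>i\<in>{1..N}. \<forall>j\<in>{1..N}. (i, j) \<in> S \<longleftrightarrow>
        real m * t < (\<Sum>k\<in>{1..m}. g (D1 i k, D2 j k)))"
      unfolding split_paired_Ball_Sigma by (intro ball_cong refl) (simp add: score_matches_def)
    finally show ?thesis .
  qed
  have vimage: "(\<lambda>(D1, D2). score_matches g t m N D1 D2) -` {S} \<inter> space ?DB =
      {z \<in> space ?DB. \<forall>i\<in>{1..N}. \<forall>j\<in>{1..N}. (i, j) \<in> S \<longleftrightarrow>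
      real m * t < (\<Sum>k\<in>{1..m}. g (fst z i k, snd z j k))}"
  proof (intro set_eqI)
    fix z show "z \<in> (\<lambda>(D1, D2). score_matches g t m N D1 D2) -` {S} \<inter> space ?DB \<longleftrightarrow>
      z \<in> {z \<in> space ?DB. \<forall>i\<in>{1..N}. \<forall>j\<in>{1..N}. (i, j) \<in> S \<longleftrightarrow>
      real m * t < (\<Sum>k\<in>{1..m}. g (fst z i k, snd z j k))}"
      unfolding vimage_eq Int_iff singleton_iff mem_Collect_eq split_def mem by (rule conj_commute)
  qed
  show "(\<lambda>(D1, D2). score_matches g t m N D1 D2) -` {S} \<inter> space ?DB \<in> sets ?DB"
    using pred unfolding vimage pred_def .
qed (auto simp: score_matches_def)

lemma matching_scheme_score_scheme:
  assumes g: "g \<in> borel_measurable borel"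
  shows "matching_scheme n (score_scheme g t n)"
  unfolding matching_scheme_def
proof (intro allI impI conjI ballI)
  fix m \<theta> i assume "is_labeling (n m) \<theta>"
  show "(\<lambda>(D1, D2). score_scheme g t n m (D1, \<theta>) D2 i)
      \<in> database_space m (n m) \<Otimes>\<^sub>M database_space m (n m) \<rightarrow>\<^sub>M count_space UNIV"
    \<comment> \<open>Every function on a discrete space is measurable, including the one that makes
      the arbitrary choice.\<close>
    using measurable_compose[OF measurable_score_matches[OF g, of t m "n m"],
        of "\<lambda>S. complete_labeling (n m) \<theta> S i" "count_space UNIV"]
    unfolding score_scheme_def split_def by simp
next
  fix m \<theta> D1 D2 assume "is_labeling (n m) \<theta>"
  then show "is_labeling (n m) (score_scheme g t n m (D1, \<theta>) D2)"
    unfolding score_scheme_def prod.case by (rule complete_labeling(1))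
qed

lemma matching_pairs_partner1:
  assumes "is_labeling N \<theta>1" "is_labeling N \<theta>2" "j \<in> {1..N}"
  shows "\<exists>i. (i, j) \<in> matching_pairs N \<theta>1 \<theta>2"
proof -
  have "\<theta>2 j \<in> \<theta>1 ` {1..N}" using assms by (auto simp: is_labeling_def bij_betw_def)
  then show ?thesis using assms(3) by (force simp: matching_pairs_def)
qed

lemma matching_pairs_partner2:
  assumes "is_labeling N \<theta>1" "is_labeling N \<theta>2" "i \<in> {1..N}"
  shows "\<exists>j. (i, j) \<in> matching_pairs N \<theta>1 \<theta>2"
  using matching_pairs_partner1[OF assms(2,1,3)] by (auto simp: matching_pairs_def)

section \<open>One database pair: laws of entries and error events\<close>

section \<open>Success probability\<close>

locale iid_databases =
  fixes M :: "'a measure" and P :: "(real \<times> real) measure" and m N :: nat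
    and \<theta>1 \<theta>2 :: labeling and U1 U2 :: "nat \<Rightarrow> nat \<Rightarrow> 'a \<Rightarrow> real"
  assumes labelings: "is_labeling N \<theta>1" "is_labeling N \<theta>2"
    and pair: "iid_database_pair M P m N \<theta>1 \<theta>2 U1 U2"
    and m_pos: "m \<ge> 1"

sublocale iid_databases \<subseteq> prob_space M
  using pair by (simp add: iid_database_pair_def)

context iid_databases
begin

abbreviation "matched \<equiv> matching_pairs N \<theta>1 \<theta>2"

lemma matched_unique:
  assumes "(i, j) \<in> matched" "(i', j') \<in> matched"
  shows "i = i' \<longleftrightarrow> j = j'"
proof -
  have "inj_on \<theta>1 {1..N}" "inj_on \<theta>2 {1..N}" using labelings by (auto simp: is_labeling_def bij_betw_def)
  then show ?thesis using assms inj_on_eq_iff[of \<theta>1 "{1..N}" i i'] inj_on_eq_iff[of \<theta>2 "{1..N}" j j']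
    by (auto simp: matching_pairs_def)
qed

lemma coordinates:
  assumes "(i, j) \<in> matched"
  shows "indep_vars (\<lambda>_. borel) (\<lambda>k \<omega>. (U1 i k \<omega>, U2 j k \<omega>)) {1..m}"
    and "k \<in> {1..m} \<Longrightarrow> distr M borel (\<lambda>\<omega>. (U1 i k \<omega>, U2 j k \<omega>)) = P"
  using pair assms by (auto simp: iid_database_pair_def)

text \<open>The model only speaks about matching pairs. Since every entry lies in one, its own law
  follows by projecting that pair; \<open>coordinates2\<close> is the mirror image.\<close>

lemma coordinates1:
  assumes "i \<in> {1..N}"
  shows "indep_vars (\<lambda>_. borel) (U1 i) {1..m}"
    and "k \<in> {1..m} \<Longrightarrow> distr M borel (U1 i k) = distr P borel fst"
proof -
  obtain j where ij: "(i, j) \<in> matched"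
    using matching_pairs_partner2[OF labelings assms] by blast
  note c = coordinates[OF ij]
  show "indep_vars (\<lambda>_. borel) (U1 i) {1..m}"
    using indep_vars_compose2[OF c(1), of "\<lambda>_. fst" "\<lambda>_. borel"] by (simp add: borel_prod[symmetric])
  assume k: "k \<in> {1..m}"
  then have "(\<lambda>\<omega>. (U1 i k \<omega>, U2 j k \<omega>)) \<in> borel_measurable M"
    using c(1) by (auto simp: indep_vars_def)
  then show "distr M borel (U1 i k) = distr P borel fst"
    by (subst c(2)[OF k, symmetric], subst distr_distr) (auto simp: comp_def borel_prod[symmetric])
qed

lemma coordinates2:
  assumes "j \<in> {1..N}"
  shows "indep_vars (\<lambda>_. borel) (U2 j) {1..m}"
    and "k \<in> {1..m} \<Longrightarrow> distr M borel (U2 j k) = distr P borel snd"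
proof -
  obtain i where ij: "(i, j) \<in> matched"
    using matching_pairs_partner1[OF labelings assms] by blast
  note c = coordinates[OF ij]
  show "indep_vars (\<lambda>_. borel) (U2 j) {1..m}"
    using indep_vars_compose2[OF c(1), of "\<lambda>_. snd" "\<lambda>_. borel"] by (simp add: borel_prod[symmetric])
  assume k: "k \<in> {1..m}"
  then have "(\<lambda>\<omega>. (U1 i k \<omega>, U2 j k \<omega>)) \<in> borel_measurable M"
    using c(1) by (auto simp: indep_vars_def)
  then show "distr M borel (U2 j k) = distr P borel snd"
    by (subst c(2)[OF k, symmetric], subst distr_distr) (auto simp: comp_def borel_prod[symmetric])
qed

lemma coordinate_measurable [measurable]:
  assumes "i \<in> {1..N}" "k \<in> {1..m}"
  shows "U1 i k \<in> borel_measurable M" "U2 i k \<in> borel_measurable M"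
  using coordinates1(1)[OF assms(1)] coordinates2(1)[OF assms(1)] assms(2) by (auto simp: indep_vars_def)

lemma measurable_database:
  "database m N U1 \<in> M \<rightarrow>\<^sub>M database_space m N" "database m N U2 \<in> M \<rightarrow>\<^sub>M database_space m N"
  unfolding database_def database_space_def entry_def by (intro measurable_restrict coordinate_measurable; simp)+

text \<open>The two entries lie in the matching pairs \<open>(i, j')\<close> and
  \<open>(i', j)\<close>. These are distinct because \<open>(i, j)\<close> is not matched, hence
  independent, and projecting preserves independence.\<close>

lemma unmatched_independent:
  assumes i: "i \<in> {1..N}" and j: "j \<in> {1..N}" and un: "(i, j) \<notin> matched"
  shows "indep_var (\<Pi>\<^sub>M k\<in>{1..m}. borel) (entry m (U1 i)) (\<Pi>\<^sub>M k\<in>{1..m}. borel) (entry m (U2 j))"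
proof -
  obtain i' where i': "(i', j) \<in> matched" using matching_pairs_partner1[OF labelings j] by blast
  obtain j' where j': "(i, j') \<in> matched" using matching_pairs_partner2[OF labelings i] by blast
  let ?X = "\<lambda>(i1, i2) \<omega>. (entry m (U1 i1) \<omega>, entry m (U2 i2) \<omega>)"
  let ?S = "\<lambda>_. (\<Pi>\<^sub>M k\<in>{1..m}. borel) \<Otimes>\<^sub>M (\<Pi>\<^sub>M k\<in>{1..m}. borel)"
  have "indep_vars ?S ?X matched" using pair by (simp add: iid_database_pair_def)
  from indep_var_restrict[OF this, of "{(i, j')}" "{(i', j)}"]
  have "indep_var (Pi\<^sub>M {(i, j')} ?S) (\<lambda>\<omega>. \<lambda>p\<in>{(i, j')}. ?X p \<omega>)
      (Pi\<^sub>M {(i', j)} ?S) (\<lambda>\<omega>. \<lambda>p\<in>{(i', j)}. ?X p \<omega>)"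
    using i' j' un by auto
  then have "indep_var (\<Pi>\<^sub>M k\<in>{1..m}. borel) ((\<lambda>x. fst (x (i, j'))) \<circ> (\<lambda>\<omega>. \<lambda>p\<in>{(i, j')}. ?X p \<omega>))
      (\<Pi>\<^sub>M k\<in>{1..m}. borel) ((\<lambda>x. snd (x (i', j))) \<circ> (\<lambda>\<omega>. \<lambda>p\<in>{(i', j)}. ?X p \<omega>))"
    by (rule indep_var_compose)
      (rule measurable_compose[OF measurable_component_singleton], simp, simp)+
  then show ?thesis by (simp add: comp_def)
qed

end

lemma (in iid_databases) score_scheme_event:
  assumes g: "g \<in> borel_measurable borel" and N: "n m = N" and j: "j \<in> {1..N}"
  shows "{\<omega>\<in>space M. score_scheme g t n m (database m N U1 \<omega>, \<theta>1) (database m N U2 \<omega>) j = \<theta>2 j} \<in> events"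
proof -
  have "(\<lambda>(D1, D2). score_scheme g t n m (D1, \<theta>1) D2 j)
    \<in> database_space m N \<Otimes>\<^sub>M database_space m N \<rightarrow>\<^sub>M count_space UNIV"
    using matching_scheme_score_scheme[OF g, of n t] m_pos labelings(1) j
    unfolding matching_scheme_def N[symmetric] by blast
  from measurable_compose[OF measurable_Pair[OF measurable_database] this]
  have [measurable]: "(\<lambda>\<omega>. score_scheme g t n m (database m N U1 \<omega>, \<theta>1) (database m N U2 \<omega>) j)
    \<in> M \<rightarrow>\<^sub>M count_space UNIV" by simp
  show ?thesis by measurable
qed

text \<open>The label of \<open>j\<close> can only go wrong if its true pair \<open>(i, j)\<close>
  is implausible or shares an index with another plausible pair. The union bound thus runs over one
  row and one column, linear in \<open>N\<close>, and not over all pairs.\<close>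

lemma (in iid_databases) prob_score_scheme:
  fixes g :: "real \<times> real \<Rightarrow> real" and t B :: real
  defines "\<mu> \<equiv> \<integral>z. g z \<partial>P"
  assumes g[measurable]: "g \<in> borel_measurable borel" and B: "\<And>z. \<bar>g z\<bar> \<le> B" "B > 0"
    and le_1: "(\<integral>\<^sup>+z. ennreal (2 powr g z) \<partial>(distr P borel fst \<Otimes>\<^sub>M distr P borel snd)) \<le> 1"
    and t: "t \<le> \<mu>" and N: "n m = N" and j: "j \<in> {1..N}"
  shows "prob {\<omega>\<in>space M. score_scheme g t n m (database m N U1 \<omega>, \<theta>1) (database m N U2 \<omega>) j = \<theta>2 j}
    \<ge> 1 - (exp (- real m * (\<mu> - t)\<^sup>2 / (2 * B\<^sup>2)) + 2 * real N * 2 powr - (real m * t))"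
    (is "prob ?E \<ge> 1 - (?\<epsilon> + 2 * real N * ?\<delta>)")
proof -
  define s where "s i j \<omega> = (\<Sum>k\<in>{1..m}. g (U1 i k \<omega>, U2 j k \<omega>))" for i j \<omega>
  have s_meas[measurable]: "s i j \<in> borel_measurable M" if "i \<in> {1..N}" "j \<in> {1..N}" for i j
    unfolding s_def
  proof (rule borel_measurable_sum)
    fix k assume k: "k \<in> {1..m}"
    note [measurable] = coordinate_measurable(1)[OF that(1) k] coordinate_measurable(2)[OF that(2) k]
    show "(\<lambda>\<omega>. g (U1 i k \<omega>, U2 j k \<omega>)) \<in> borel_measurable M" by measurable
  qed
  obtain i where ij: "(i, j) \<in> matched" using matching_pairs_partner1[OF labelings j] by blast
  then have i: "i \<in> {1..N}" and \<theta>: "\<theta>1 i = \<theta>2 j" by (auto simp: matching_pairs_def)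
  define false_match where "false_match i j = {\<omega>\<in>space M. real m * t < s i j \<omega>}" for i j
  define missed where "missed = {\<omega>\<in>space M. s i j \<omega> \<le> real m * t}"
  have meas: "false_match i j \<in> events" if "i \<in> {1..N}" "j \<in> {1..N}" for i j
  proof -
    note [measurable] = s_meas[OF that]
    show ?thesis unfolding false_match_def by measurable
  qed
  have missed[measurable]: "missed \<in> events"
  proof -
    note [measurable] = s_meas[OF i j]
    show ?thesis unfolding missed_def by measurable
  qed
  have "prob missed \<le> ?\<epsilon>"
    using prob_score_sum_matched[OF _ _ coordinates[OF ij] g B, of t] m_pos t
    by (simp add: missed_def s_def \<mu>_def)
  have false_le: "prob (false_match i j) \<le> ?\<delta>"
    if i: "i \<in> {1..N}" and j: "j \<in> {1..N}" and "(i, j) \<notin> matched" for i j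
    unfolding false_match_def s_def
    by (rule prob_score_sum_independent[OF _ _ coordinates1[OF i] coordinates2[OF j] _ g le_1])
      (use m_pos unmatched_independent[OF that] in \<open>auto simp: entry_def[abs_def]\<close>)
  \<comment> \<open>\<open>F1\<close> collects the wrong partners of \<open>j\<close>,
    \<open>F2\<close> those of its true partner \<open>i\<close>. By uniqueness of matching partners
    all these pairs are unmatched, so \<open>false_le\<close> applies.\<close>
  define F1 where "F1 = (\<Union>i'\<in>{1..N} - {i}. false_match i' j)"
  define F2 where "F2 = (\<Union>j'\<in>{1..N} - {j}. false_match i j')"
  have [measurable]: "F1 \<in> events" "F2 \<in> events"
    unfolding F1_def F2_def using meas i j by (auto intro!: sets.finite_UN)
  have F1: "prob F1 \<le> real (card ({1..N} - {i})) * ?\<delta>" unfolding F1_def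
    by (intro prob_finite_UN_le meas false_le) (use j ij in \<open>auto dest: matched_unique\<close>)
  have F2: "prob F2 \<le> real (card ({1..N} - {j})) * ?\<delta>" unfolding F2_def
    by (intro prob_finite_UN_le meas false_le) (use i ij in \<open>auto dest: matched_unique\<close>)
  have card: "real (card ({1..N} - {i})) * ?\<delta> \<le> real N * ?\<delta>" for i
    using card_Diff1_le[of "{1..N}" i] by (intro mult_right_mono) auto
  have "prob (missed \<union> (F1 \<union> F2)) \<le> prob missed + (prob F1 + prob F2)"
    by (intro order_trans[OF measure_Un_le] add_left_mono measure_Un_le) auto
  also have "\<dots> \<le> ?\<epsilon> + (real N * ?\<delta> + real N * ?\<delta>)"
    using \<open>prob missed \<le> ?\<epsilon>\<close> F1 F2 card[of i] card[of j] by linarith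
  finally have bad: "prob (missed \<union> (F1 \<union> F2)) \<le> ?\<epsilon> + 2 * real N * ?\<delta>" by simp
  have E: "?E \<in> events" by (rule score_scheme_event[where j=j]) (use g N j in auto)
  \<comment> \<open>Off the error events \<open>(i, j)\<close> is an isolated plausible pair, so the
    completed labeling must give \<open>j\<close> the label \<open>\<theta>1 i\<close>, which is
    \<open>\<theta>2 j\<close>.\<close>
  have "space M - (missed \<union> (F1 \<union> F2)) \<subseteq> ?E"
  proof
    fix \<omega> assume \<omega>: "\<omega> \<in> space M - (missed \<union> (F1 \<union> F2))"
    let ?S = "score_matches g t m N (database m N U1 \<omega>) (database m N U2 \<omega>)"
    have S: "(i, j) \<in> ?S \<longleftrightarrow> real m * t < s i j \<omega>" if "i \<in> {1..N}" "j \<in> {1..N}" for i j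
    proof -
      have "(\<Sum>k\<in>{1..m}. g (database m N U1 \<omega> i k, database m N U2 \<omega> j k)) = s i j \<omega>"
        unfolding s_def using that by (intro sum.cong) (auto simp: database_def entry_def)
      then show ?thesis using that by (simp add: score_matches_def)
    qed
    have "real m * t < s i j \<omega>" using \<omega> by (auto simp: missed_def)
    then have "(i, j) \<in> ?S" using S[OF i j] by blast
    moreover have "i' = i" if "i' \<in> {1..N}" "(i', j) \<in> ?S" for i'
      using that S[OF that(1) j] \<omega> by (auto simp: F1_def false_match_def)
    moreover have "j' = j" if "j' \<in> {1..N}" "(i, j') \<in> ?S" for j'
      using that S[OF i that(1)] \<omega> by (auto simp: F2_def false_match_def)
    ultimately have "(i, j) \<in> mutual_matches N ?S" using i j unfolding mutual_matches_def by blast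
    from complete_labeling(2)[OF labelings(1) this] show "\<omega> \<in> ?E"
      using \<omega> \<theta> by (simp add: score_scheme_def N)
  qed
  then have "prob (space M - (missed \<union> (F1 \<union> F2))) \<le> prob ?E" by (intro finite_measure_mono E)
  then show ?thesis using bad by (simp add: prob_compl)
qed

section \<open>Averaging over the uniform index, and the limit in \<open>m\<close>\<close>

lemma success_probability_ge:
  assumes M: "prob_space M" and N: "N \<ge> 1"
    and meas: "\<And>j. j \<in> {1..N} \<Longrightarrow>
      {\<omega>\<in>space M. f (database m N U1 \<omega>, \<theta>1) (database m N U2 \<omega>) j = \<theta>2 j} \<in> sets M"
    and ge: "\<And>j. j \<in> {1..N} \<Longrightarrow>
      c \<le> measure M {\<omega>\<in>space M. f (database m N U1 \<omega>, \<theta>1) (database m N U2 \<omega>) j = \<theta>2 j}"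
  shows "c \<le> success_probability M m N \<theta>1 \<theta>2 U1 U2 f"
proof -
  interpret M: prob_space M by fact
  interpret J: prob_space "uniform_count_measure {1..N}"
    using N by (intro prob_space_uniform_count_measure) auto
  interpret MJ: pair_prob_space M "uniform_count_measure {1..N}" ..
  define E where "E j = {\<omega>\<in>space M. f (database m N U1 \<omega>, \<theta>1) (database m N U2 \<omega>) j = \<theta>2 j}" for j
  have E: "E j \<in> sets M" "c \<le> measure M (E j)" if "j \<in> {1..N}" for j
    using meas ge that by (simp_all add: E_def)
  \<comment> \<open>The success event is sliced by the value of \<open>J\<close>. Each slice is a
    rectangle of weight \<open>1 / N\<close>, so the success probability is an average over
    \<open>j\<close>.\<close>
  have ms: "measure (M \<Otimes>\<^sub>M uniform_count_measure {1..N}) (E j \<times> {j}) = measure M (E j) / N"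
    if "j \<in> {1..N}" for j
  proof -
    have "emeasure (M \<Otimes>\<^sub>M uniform_count_measure {1..N}) (E j \<times> {j})
        = emeasure M (E j) * emeasure (uniform_count_measure {1..N}) {j}"
      by (rule J.emeasure_pair_measure_Times) (use that E in \<open>auto simp: sets_uniform_count_measure\<close>)
    moreover have "emeasure (uniform_count_measure {1..N}) {j} = ennreal (1 / N)"
      using emeasure_uniform_count_measure[of "{1..N}" "{j}"] that by simp
    ultimately show ?thesis by (simp add: measure_def enn2real_mult)
  qed
  have "success_probability M m N \<theta>1 \<theta>2 U1 U2 f
      = measure (M \<Otimes>\<^sub>M uniform_count_measure {1..N}) (\<Union>j\<in>{1..N}. E j \<times> {j})"
    unfolding success_probability_def E_def by (rule arg_cong[where f="measure _"]) blast
  also have "\<dots> = (\<Sum>j\<in>{1..N}. measure (M \<Otimes>\<^sub>M uniform_count_measure {1..N}) (E j \<times> {j}))"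
  proof (rule MJ.P.finite_measure_finite_Union)
    have "E j \<times> {j} \<in> sets (M \<Otimes>\<^sub>M uniform_count_measure {1..N})" if "j \<in> {1..N}" for j
      by (rule pair_measureI[OF E(1)[OF that]]) (use that in \<open>simp add: sets_uniform_count_measure\<close>)
    then show "(\<lambda>j. E j \<times> {j}) ` {1..N} \<subseteq> sets (M \<Otimes>\<^sub>M uniform_count_measure {1..N})" by blast
    show "disjoint_family_on (\<lambda>j. E j \<times> {j}) {1..N}" unfolding disjoint_family_on_def by blast
  qed simp
  also have "\<dots> = (\<Sum>j\<in>{1..N}. measure M (E j) / N)" by (intro sum.cong ms) auto
  also have "\<dots> \<ge> (\<Sum>j\<in>{1..N}. c / N)" by (intro sum_mono divide_right_mono E) auto
  finally show ?thesis using N by simp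
qed

lemma success_probability_le_1:
  assumes "prob_space M" "N \<ge> 1"
  shows "success_probability M m N \<theta>1 \<theta>2 U1 U2 f \<le> 1"
proof -
  interpret pair_prob_space M "uniform_count_measure {1..N}"
    using assms prob_space_uniform_count_measure[of "{1..N}"]
    by (simp add: pair_prob_space_def pair_sigma_finite_def prob_space_imp_sigma_finite)
  show ?thesis unfolding success_probability_def by (rule P.prob_le_1)
qed

text \<open>For \<open>r\<close> strictly between \<open>R\<close> and \<open>t\<close>, eventually
  \<open>n m < 2 powr (m * r)\<close>, and the product is dominated by a geometric sequence of ratio
  \<open>2 powr (r - t) < 1\<close>.\<close>

lemma growth_rate_tendsto_0:
  assumes n: "\<forall>m\<ge>1. n m \<ge> 1" and R: "(\<lambda>m. 1 / real m * log 2 (real (n m))) \<longlonglongrightarrow> R" and "R < t"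
  shows "(\<lambda>m. real (n m) * 2 powr - (real m * t)) \<longlonglongrightarrow> 0"
proof -
  obtain r where r: "R < r" "r < t" using \<open>R < t\<close> dense by blast
  have upper: "\<forall>\<^sub>F m in sequentially. real (n m) * 2 powr - (real m * t) \<le> 2 powr (real m * (r - t))"
    using order_tendstoD(2)[OF R r(1)] eventually_ge_at_top[of 1]
  proof eventually_elim
    case (elim m)
    then have pos: "real (n m) > 0" using n by (auto simp: Suc_le_eq)
    have "log 2 (real (n m)) = real m * (1 / real m * log 2 (real (n m)))" using elim(2) by simp
    also have "\<dots> < real m * r" using elim by (intro mult_strict_left_mono) auto
    finally have "real (n m) < 2 powr (real m * r)" using log_less_iff[of 2 "real (n m)"] pos by simp
    then have "real (n m) \<le> 2 powr (real m * r)" by (rule less_imp_le)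
    then have "real (n m) * 2 powr - (real m * t) \<le> 2 powr (real m * r) * 2 powr - (real m * t)"
      by (intro mult_right_mono) auto
    also have "\<dots> = 2 powr (real m * (r - t))"
      unfolding powr_add[symmetric] by (simp add: right_diff_distrib)
    finally show ?case .
  qed
  have lim: "(\<lambda>m. 2 powr (real m * (r - t))) \<longlonglongrightarrow> 0"
  proof -
    have "2 powr (r - t) < 1" using r powr_less_mono[of "r - t" 0 2] by simp
    then have "(\<lambda>m. (2 powr (r - t)) ^ m) \<longlonglongrightarrow> 0" by (intro LIMSEQ_realpow_zero) auto
    then show ?thesis by (simp add: powr_power)
  qed
  show ?thesis by (rule tendsto_sandwich[OF _ upper tendsto_const lim]) simp
qed

text \<open>Follows the cases in \<open>mutual_information_bits\<close>: both ways of being infinite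
  admit scores for every \<open>t\<close>, and otherwise the value is the relative entropy of
  \<open>P\<close> with respect to the product of its marginals.\<close>

lemma bounded_score_mutual_information:
  assumes P: "prob_space P" "sets P = sets borel" and t: "ereal t < mutual_information_bits P"
  shows "\<exists>g. bounded_score (distr P borel fst \<Otimes>\<^sub>M distr P borel snd) P t g"
proof -
  let ?Q = "distr P borel fst \<Otimes>\<^sub>M distr P borel snd"
  have [measurable]: "fst \<in> borel_measurable P" "snd \<in> borel_measurable P"
    using P(2) by (simp_all add: borel_prod[symmetric] cong: measurable_cong_sets)
  have sets: "sets P = sets ?Q" using P(2) by (simp add: borel_prod[symmetric] cong: sets_pair_measure_cong)
  interpret P: prob_space P by fact
  interpret P1: prob_space "distr P borel fst" by (rule P.prob_space_distr) simp
  interpret P2: prob_space "distr P borel snd" by (rule P.prob_space_distr) simp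
  interpret Q: pair_prob_space "distr P borel fst" "distr P borel snd" ..
  have joint: "distr P (borel \<Otimes>\<^sub>M borel) (\<lambda>u. (fst u, snd u)) = P"
    using P(2) by (simp add: borel_prod distr_id2)
  have KL: "t < KL_divergence 2 ?Q P"
    if "absolutely_continuous ?Q P" "integrable P (entropy_density 2 ?Q P)"
    using t that by (simp add: mutual_information_bits_def Let_def joint P.mutual_information_def del: prod.collapse)
  show ?thesis
    using bounded_score_singular[OF Q.P.prob_space_axioms P(1) sets]
      bounded_score_not_integrable[OF Q.P.prob_space_axioms P(1) sets]
      bounded_score_integrable[OF Q.P.prob_space_axioms P(1) sets _ _ KL] by blast
qed

theorem corollary1:
  fixes P :: "(real \<times> real) measure" and n :: "nat \<Rightarrow> nat" and R :: real
  assumes "prob_space P" and "sets P = sets borel"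
    and "\<forall>m\<ge>1. n m \<ge> 1" and "mono_on {1..} n"
    and "(\<lambda>m. 1 / real m * log 2 (real (n m))) \<longlonglongrightarrow> R"
    and "ereal R < mutual_information_bits P"
  shows "\<exists>f. matching_scheme n f \<and>
    (\<forall>(M :: nat \<Rightarrow> 'a measure) \<Theta>1 \<Theta>2 U1 U2.
      iid_database_family M P n \<Theta>1 \<Theta>2 U1 U2 \<longrightarrow> successful f M n \<Theta>1 \<Theta>2 U1 U2)"
proof -
  \<comment> \<open>The threshold leaves room on both sides: \<open>R < t\<close> makes the expected
    number of wrong partners vanish, and \<open>t\<close> below the mutual information lets matching
    pairs exceed it.\<close>
  obtain t where t: "R < t" "ereal t < mutual_information_bits P"
    using ereal_dense2[OF assms(6)] by auto
  obtain g where score: "bounded_score (distr P borel fst \<Otimes>\<^sub>M distr P borel snd) P t g"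
    using bounded_score_mutual_information[OF assms(1,2) t(2)] by blast
  have g[measurable]: "g \<in> borel_measurable borel"
  proof -
    have "sets (distr P borel fst \<Otimes>\<^sub>M distr P borel snd) = sets (borel :: (real \<times> real) measure)"
      unfolding borel_prod[symmetric] by (rule sets_pair_measure_cong) simp_all
    from measurable_cong_sets[OF this refl] show ?thesis
      using conjunct1[OF score[unfolded bounded_score_def]] by blast
  qed
  obtain B0 where B0: "\<And>z. \<bar>g z\<bar> \<le> B0" using score by (auto simp: bounded_score_def)
  \<comment> \<open>The maximum with 1 makes the bound positive, as Hoeffding's inequality
    requires.\<close>
  define B where "B = max 1 B0"
  have B: "\<bar>g z\<bar> \<le> B" "B > 0" for z using B0[of z] by (auto simp: B_def)
  define \<mu> where "\<mu> = (\<integral>z. g z \<partial>P)"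
  have \<mu>: "t < \<mu>"
    and le_1: "(\<integral>\<^sup>+z. ennreal (2 powr g z) \<partial>(distr P borel fst \<Otimes>\<^sub>M distr P borel snd)) \<le> 1"
    using score by (auto simp: bounded_score_def \<mu>_def)
  \<comment> \<open>A lower bound on the success probability that involves neither the labelings nor
    the probability spaces.\<close>
  define c where "c m = 1 - (exp (- real m * (\<mu> - t)\<^sup>2 / (2 * B\<^sup>2))
    + 2 * (real (n m) * 2 powr - (real m * t)))" for m
  define d where "d = - ((\<mu> - t)\<^sup>2 / (2 * B\<^sup>2))"
  have "exp d < 1" using \<mu> B by (simp add: d_def)
  then have "(\<lambda>m. exp d ^ m) \<longlonglongrightarrow> 0" by (intro LIMSEQ_realpow_zero) auto
  then have "(\<lambda>m. exp (- real m * (\<mu> - t)\<^sup>2 / (2 * B\<^sup>2))) \<longlonglongrightarrow> 0"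
    by (simp add: d_def exp_of_nat_mult[symmetric])
  then have "c \<longlonglongrightarrow> 1 - (0 + 2 * 0)"
    unfolding c_def by (intro tendsto_intros growth_rate_tendsto_0[OF assms(3,5) t(1)])
  then have c: "c \<longlonglongrightarrow> 1" by simp
  show ?thesis
  proof (intro exI conjI allI impI)
    \<comment> \<open>The witness is built from \<open>g\<close>, \<open>t\<close> and
      \<open>n\<close> alone, before any labeling is introduced.\<close>
    show "matching_scheme n (score_scheme g t n)" by (rule matching_scheme_score_scheme[OF g])
    fix M :: "nat \<Rightarrow> 'a measure" and \<Theta>1 \<Theta>2 U1 U2
    assume fam: "iid_database_family M P n \<Theta>1 \<Theta>2 U1 U2"
    have bounds: "c m \<le> success_probability (M m) m (n m) (\<Theta>1 m) (\<Theta>2 m) (U1 m) (U2 m) (score_scheme g t n m)"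
      "success_probability (M m) m (n m) (\<Theta>1 m) (\<Theta>2 m) (U1 m) (U2 m) (score_scheme g t n m) \<le> 1"
      if m: "m \<ge> 1" for m
    proof -
      interpret iid_databases "M m" P m "n m" "\<Theta>1 m" "\<Theta>2 m" "U1 m" "U2 m"
        using fam m by unfold_locales (auto simp: iid_database_family_def labeling_family_def)
      have N: "n m \<ge> 1" using assms(3) m by blast
      note * = prob_score_scheme[OF g B le_1, of t n, OF less_imp_le[OF \<mu>[unfolded \<mu>_def]] refl]
      show "c m \<le> success_probability (M m) m (n m) (\<Theta>1 m) (\<Theta>2 m) (U1 m) (U2 m) (score_scheme g t n m)"
        using * by (intro success_probability_ge[OF prob_space_axioms N] score_scheme_event g refl) (auto simp: c_def \<mu>_def mult.assoc)
      show "success_probability (M m) m (n m) (\<Theta>1 m) (\<Theta>2 m) (U1 m) (U2 m) (score_scheme g t n m) \<le> 1"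
        by (rule success_probability_le_1[OF prob_space_axioms N])
    qed
    show "successful (score_scheme g t n) M n \<Theta>1 \<Theta>2 U1 U2"
      unfolding successful_def
      \<comment> \<open>The bounds hold from \<open>m = 1\<close> on; the model says nothing about
        \<open>m = 0\<close>, which the limit ignores.\<close>
      by (rule tendsto_sandwich[OF _ _ c tendsto_const])
        (use bounds in \<open>auto intro!: eventually_sequentiallyI[of 1]\<close>)
  qed
qed

end
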